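(* Let $d\ge1$ and let $Z$ be a subdivided $d$-SMNBP. Let $P$ be a source-sink path of $Z$ that is not read-once, and let $v$ and $w$ be the pre-pivot and the pivot of $P$, respectively. Then $Z_v$, regarded as a branching program with source $v$ and the sink of $Z$ as sink, is a subdivided $(d-1)$-SMNBP.
   Context: An NBP is a directed acyclic graph, multiple edges allowed, with one source and one sink, some of whose edges are labelled with literals. A path is read-once if no two of its edges are labelled with the same variable. A $d$-SMNBP is an NBP with no negative literal labels in which along every path each variable labels at most $d$ edges, and every source-sink path can be partitioned into at most $d$ edge-disjoint consecutive read-once subpaths. A junction vertex is a vertex with in-degree or out-degree greater than one (counting parallel edges); otherwise it is a subdivision vertex. The program is subdivided if no edge joins two junction vertices and both endpoints of every labelled edge are subdivision vertices. A vertex $u$ is read-once if every path from the source to $u$ is read-once, and non-read-once otherwise. For a source-sink path $P$ that is not read-once, the pivot of $P$ is the first vertex of $P$ (the one closest to the source along $P$) that is non-read-once, and the pre-pivot is the vertex immediately preceding the pivot on $P$. $Z_v$ is the subgraph of $Z$ induced by $v$ and all vertices reachable from $v$, with labels preserved. *)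

theory Defs
  imports "Graph_Theory.Graph_Theory"
begin

datatype 'x literal = Pos 'x | Neg 'x

fun lit_var :: "'x literal \<Rightarrow> 'x" where
  "lit_var (Pos x) = x"
| "lit_var (Neg x) = x"

text \<open>An edge carrying \<open>None\<close> is unlabelled. Parallel edges are distinct arcs with the same ends.\<close>

record ('v, 'e, 'x) branching_program =
  bp_graph :: "('v, 'e) pre_digraph"
  source :: 'v
  sink :: 'v
  label :: "'e \<Rightarrow> 'x literal option"

definition nbp :: "('v, 'e, 'x) branching_program \<Rightarrow> bool" where
  "nbp Z \<longleftrightarrow>
     fin_digraph (bp_graph Z) \<and>
     (\<nexists>c. pre_digraph.cycle (bp_graph Z) c) \<and>
     {u \<in> verts (bp_graph Z). in_degree (bp_graph Z) u = 0} = {source Z} \<and>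
     {u \<in> verts (bp_graph Z). out_degree (bp_graph Z) u = 0} = {sink Z}"

abbreviation edge_var :: "('v, 'e, 'x) branching_program \<Rightarrow> 'e \<Rightarrow> 'x option" where
  "edge_var Z e \<equiv> map_option lit_var (label Z e)"

abbreviation bp_path :: "('v, 'e, 'x) branching_program \<Rightarrow> 'v \<Rightarrow> 'e list \<Rightarrow> 'v \<Rightarrow> bool" where
  "bp_path Z \<equiv> pre_digraph.apath (bp_graph Z)"

abbreviation path_verts :: "('v, 'e, 'x) branching_program \<Rightarrow> 'v \<Rightarrow> 'e list \<Rightarrow> 'v list" where
  "path_verts Z \<equiv> pre_digraph.awalk_verts (bp_graph Z)"

text \<open>The lists of edges below are (sub)paths, so their entries are pairwise distinct and it is
  enough to compare the edges in \<open>set p\<close>.\<close>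

definition read_once :: "('v, 'e, 'x) branching_program \<Rightarrow> 'e list \<Rightarrow> bool" where
  "read_once Z p \<longleftrightarrow>
     (\<forall>e \<in> set p. \<forall>f \<in> set p. \<forall>x.
        edge_var Z e = Some x \<and> edge_var Z f = Some x \<longrightarrow> e = f)"

text \<open>Consecutive edge-disjoint subpaths partitioning a path \<open>p\<close> are exactly the entries of
  a list of edge lists whose concatenation is \<open>p\<close>.\<close>

definition smnbp :: "nat \<Rightarrow> ('v, 'e, 'x) branching_program \<Rightarrow> bool" where
  "smnbp d Z \<longleftrightarrow>
     nbp Z \<and>
     (\<forall>e \<in> arcs (bp_graph Z). \<forall>x. label Z e \<noteq> Some (Neg x)) \<and>
     (\<forall>a p b x. bp_path Z a p b \<longrightarrow> card {e \<in> set p. edge_var Z e = Some x} \<le> d) \<and>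
     (\<forall>p. bp_path Z (source Z) p (sink Z) \<longrightarrow>
        (\<exists>ps. concat ps = p \<and> length ps \<le> d \<and> (\<forall>q \<in> set ps. read_once Z q)))"

definition junction :: "('v, 'e, 'x) branching_program \<Rightarrow> 'v \<Rightarrow> bool" where
  "junction Z u \<longleftrightarrow>
     u \<in> verts (bp_graph Z) \<and> (in_degree (bp_graph Z) u > 1 \<or> out_degree (bp_graph Z) u > 1)"

definition subdivision_vertex :: "('v, 'e, 'x) branching_program \<Rightarrow> 'v \<Rightarrow> bool" where
  "subdivision_vertex Z u \<longleftrightarrow> u \<in> verts (bp_graph Z) \<and> \<not> junction Z u"

definition subdivided :: "('v, 'e, 'x) branching_program \<Rightarrow> bool" where
  "subdivided Z \<longleftrightarrow>
     (\<forall>e \<in> arcs (bp_graph Z).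
        \<not> (junction Z (tail (bp_graph Z) e) \<and> junction Z (head (bp_graph Z) e)) \<and>
        (label Z e \<noteq> None \<longrightarrow>
           subdivision_vertex Z (tail (bp_graph Z) e) \<and>
           subdivision_vertex Z (head (bp_graph Z) e)))"

definition read_once_vertex :: "('v, 'e, 'x) branching_program \<Rightarrow> 'v \<Rightarrow> bool" where
  "read_once_vertex Z u \<longleftrightarrow> (\<forall>p. bp_path Z (source Z) p u \<longrightarrow> read_once Z p)"

text \<open>The following two are used for source-sink paths \<open>P\<close> that are not read-once; the pivot then
  exists, because the sink is non-read-once, and it has a predecessor, because the source is
  read-once.\<close>

definition is_pivot :: "('v, 'e, 'x) branching_program \<Rightarrow> 'e list \<Rightarrow> 'v \<Rightarrow> bool" where
  "is_pivot Z P w \<longleftrightarrow>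
     (\<exists>us ws. path_verts Z (source Z) P = us @ w # ws \<and>
        \<not> read_once_vertex Z w \<and> (\<forall>u \<in> set us. read_once_vertex Z u))"

definition is_pre_pivot :: "('v, 'e, 'x) branching_program \<Rightarrow> 'e list \<Rightarrow> 'v \<Rightarrow> bool" where
  "is_pre_pivot Z P v \<longleftrightarrow>
     (\<exists>us w ws. path_verts Z (source Z) P = us @ v # w # ws \<and> is_pivot Z P w)"

definition sub_program :: "('v, 'e, 'x) branching_program \<Rightarrow> 'v \<Rightarrow> ('v, 'e, 'x) branching_program" where
  "sub_program Z v =
     Z\<lparr>bp_graph := bp_graph Z \<restriction> {u. v \<rightarrow>\<^sup>*\<^bsub>bp_graph Z\<^esub> u}, source := v\<rparr>"

end

theory Submission
  imports Defs
begin

text \<open>Let \<open>Q\<close> be a path from the source to the pivot \<open>w\<close> that is not read-once, and let \<open>R\<close> be a path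
  from the pre-pivot \<open>v\<close> to the sink. If \<open>Q\<close> passes through \<open>v\<close>, its last edge is labelled because
  \<open>v\<close> is read-once, so \<open>v\<close> is a subdivision vertex and \<open>R\<close> starts with that edge. Otherwise \<open>w\<close> is
  a junction, so \<open>v\<close> is not, and \<open>R\<close> starts with the unlabelled edge from \<open>v\<close> to \<open>w\<close>. In either case
  splice \<open>Q\<close> and the part of \<open>R\<close> after \<open>w\<close>: the first of the \<open>d\<close> read-once pieces of this
  source-sink path ends before \<open>Q\<close> does, so the remaining \<open>d - 1\<close> pieces cover \<open>R\<close> up to an
  unlabelled edge. Every path of \<open>Z\<^sub>v\<close> extends to such a path \<open>R\<close>, which also bounds the
  multiplicities of the variables.\<close>

section \<open>Partitions into read-once pieces\<close>

text \<open>The last clause of \<open>smnbp\<close>, stated for arbitrary edge lists so that it can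
  be transferred to suffixes of a path. Pieces may be empty; for \<open>k = 0\<close> only the empty
  list qualifies.\<close>

definition read_once_partition :: "('v, 'e, 'x) branching_program \<Rightarrow> nat \<Rightarrow> 'e list \<Rightarrow> bool" where
  "read_once_partition Z k p \<longleftrightarrow>
     (\<exists>ps. concat ps = p \<and> length ps \<le> k \<and> (\<forall>q \<in> set ps. read_once Z q))"

lemma read_once_Nil [simp]: "read_once Z []"
  by (simp add: read_once_def)

lemma read_once_mono: "read_once Z p \<Longrightarrow> set q \<subseteq> set p \<Longrightarrow> read_once Z q"
  unfolding read_once_def by blast

lemma read_once_insert_unlabelled:
  "read_once Z p \<Longrightarrow> label Z e = None \<Longrightarrow> set q \<subseteq> insert e (set p) \<Longrightarrow> read_once Z q"
  unfolding read_once_def by (metis insertE map_option_eq_Some option.distinct(1) subsetD)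

text \<open>The piece that straddles the border loses its beginning and stays read-once; all earlier
  pieces are dropped.\<close>

lemma read_once_partition_suffix:
  assumes "read_once_partition Z k (xs @ ys)"
  shows "read_once_partition Z k ys"
proof -
  have "\<exists>qs. concat qs = ys \<and> length qs \<le> length ps \<and> (\<forall>q \<in> set qs. read_once Z q)"
    if "concat ps = xs @ ys" "\<forall>q \<in> set ps. read_once Z q" for ps
    using that
  proof (induction ps arbitrary: xs)
    case Nil
    then show ?case by simp
  next
    case (Cons q ps)
    then obtain us where "q = xs @ us \<and> us @ concat ps = ys \<or> q @ us = xs \<and> concat ps = us @ ys"
      by (auto simp: append_eq_append_conv2)
    then show ?case
    proof
      assume us: "q = xs @ us \<and> us @ concat ps = ys"
      then have "read_once Z us"
        using Cons.prems by (auto intro: read_once_mono[of Z q])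
      then show ?thesis
        using us Cons.prems by (intro exI[of _ "us # ps"]) auto
    next
      assume "q @ us = xs \<and> concat ps = us @ ys"
      then obtain qs where "concat qs = ys" "length qs \<le> length ps" "\<forall>q \<in> set qs. read_once Z q"
        using Cons.IH[of us] Cons.prems by auto
      then show ?thesis
        by (intro exI[of _ qs]) auto
    qed
  qed
  then show ?thesis
    using assms unfolding read_once_partition_def by (meson order_trans)
qed

text \<open>The edge joins the first piece, where it cannot repeat a variable. If there is no piece
  yet, it forms one by itself, and \<open>k \<noteq> 0\<close> leaves room for it.\<close>

lemma read_once_partition_Cons_unlabelled:
  assumes "read_once_partition Z k p" "k \<noteq> 0" "label Z e = None"
  shows "read_once_partition Z k (e # p)"
proof -
  obtain ps where ps: "concat ps = p" "length ps \<le> k" "\<forall>q \<in> set ps. read_once Z q"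
    using assms(1) unfolding read_once_partition_def by blast
  show ?thesis
  proof (cases ps)
    case Nil
    then show ?thesis
      using ps assms(2) read_once_insert_unlabelled[OF read_once_Nil assms(3), of "[e]"]
      unfolding read_once_partition_def by (intro exI[of _ "[[e]]"]) auto
  next
    case (Cons q qs)
    then show ?thesis
      using ps read_once_insert_unlabelled[OF _ assms(3), of q "e # q"]
      unfolding read_once_partition_def by (intro exI[of _ "(e # q) # qs"]) auto
  qed
qed

text \<open>The first piece is read-once and so cannot contain all of \<open>xs @ [y]\<close>. Hence
  it ends before \<open>y\<close>, and the other pieces cover \<open>y # ys\<close>.\<close>

lemma read_once_partition_drop_first:
  assumes "read_once_partition Z d (xs @ y # ys)" "\<not> read_once Z (xs @ [y])"
  shows "read_once_partition Z (d - 1) (y # ys) \<and> d - 1 \<noteq> 0"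
proof -
  obtain ps where ps: "concat ps = xs @ y # ys" "length ps \<le> d" "\<forall>q \<in> set ps. read_once Z q"
    using assms(1) unfolding read_once_partition_def by blast
  from ps(1) obtain q qs where qs: "ps = q # qs"
    by (cases ps) auto
  obtain us where us: "q @ us = xs" "concat qs = us @ y # ys"
  proof -
    obtain us where "q = xs @ us \<and> us @ concat qs = y # ys \<or> q @ us = xs \<and> concat qs = us @ y # ys"
      using ps(1) unfolding qs by (auto simp: append_eq_append_conv2)
    \<comment> \<open>A first piece that contains \<open>xs\<close> is exactly \<open>xs\<close>,
      because one more edge would be \<open>y\<close>.\<close>
    moreover have "us = []" if "q = xs @ us" "us @ concat qs = y # ys"
    proof (rule ccontr)
      assume "us \<noteq> []"
      then have "set (xs @ [y]) \<subseteq> set q"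
        using that by (auto simp: append_eq_Cons_conv)
      then show False
        using assms(2) ps(3) qs read_once_mono by (metis list.set_intros(1))
    qed
    ultimately show thesis using that by fastforce
  qed
  have "read_once_partition Z (d - 1) (us @ y # ys)"
    using ps us(2) unfolding qs read_once_partition_def by (intro exI[of _ qs]) auto
  \<comment> \<open>A later piece contains \<open>y\<close>, so \<open>qs\<close> is not
    empty.\<close>
  moreover have "d - 1 \<noteq> 0"
    using ps(2) us(2) unfolding qs by (cases qs) auto
  ultimately show ?thesis
    using read_once_partition_suffix by blast
qed

text \<open>Each read-once piece contributes at most one edge per variable. Thus the multiplicity
  clause of \<open>smnbp\<close> follows from partitions alone.\<close>

lemma card_variable_le_read_once_partition:
  assumes "read_once_partition Z k p"
  shows "card {e \<in> set p. edge_var Z e = Some x} \<le> k"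
proof -
  have "card {e \<in> set (concat ps). edge_var Z e = Some x} \<le> length ps"
    if "\<forall>q \<in> set ps. read_once Z q" for ps
    using that
  proof (induction ps)
    case Nil
    then show ?case by simp
  next
    case (Cons q ps)
    have "card {e \<in> set q. edge_var Z e = Some x} \<le> 1"
      using Cons.prems by (auto simp: card_le_Suc0_iff_eq read_once_def)
    moreover have "{e \<in> set (concat (q # ps)). edge_var Z e = Some x} =
        {e \<in> set q. edge_var Z e = Some x} \<union> {e \<in> set (concat ps). edge_var Z e = Some x}"
      by auto
    ultimately show ?case
      using Cons.IH Cons.prems
        card_Un_le[of "{e \<in> set q. edge_var Z e = Some x}" "{e \<in> set (concat ps). edge_var Z e = Some x}"]
      by simp
  qed
  then show ?thesis
    using assms unfolding read_once_partition_def by (meson order_trans)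
qed

section \<open>Acyclic digraphs\<close>

lemma (in wf_digraph) acyclic_awalk_closed:
  assumes "\<nexists>c. cycle c" "awalk u p u"
  shows "p = []"
  using assms closed_w_imp_cycle[of p] by (auto simp: closed_w_def)

text \<open>A repeated vertex would enclose a nonempty closed walk. Concatenations of walks are
  therefore paths, which makes splicing possible.\<close>

lemma (in wf_digraph) acyclic_awalk_imp_apath:
  assumes "\<nexists>c. cycle c" "awalk u p v"
  shows "apath u p v"
proof (rule ccontr)
  assume "\<not> apath u p v"
  then have "\<not> distinct (awalk_verts u p)"
    using assms(2) by (simp add: apath_def)
  then obtain q r s w where "0 < length r" "awalk w r w"
    using awalk_not_distinct_decomp[OF assms(2)] by blast
  then show False
    using acyclic_awalk_closed[OF assms(1)] by blast
qed

text \<open>Following out-arcs must end, since the converse arc relation of a finite acyclic digraph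
  is well-founded. In an NBP the vertex found is the sink.\<close>

lemma (in fin_digraph) acyclic_reaches_out_degree_0:
  assumes "\<nexists>c. cycle c" "u \<in> verts G"
  shows "\<exists>t. u \<rightarrow>\<^sup>* t \<and> out_degree G t = 0"
proof -
  have "acyclic (arcs_ends G)"
    using acyclic_awalk_closed[OF assms(1)] by (auto simp: acyclic_def reachable1_awalk)
  moreover have "finite (arcs_ends G)"
    by (simp add: arcs_ends_def)
  ultimately have "wf ((arcs_ends G)\<inverse>)"
    by (simp add: finite_acyclic_wf_converse)
  then show ?thesis
    using assms(2)
  proof (induction u rule: wf_induct_rule)
    case (less u)
    show ?case
    proof (cases "out_degree G u = 0")
      case True
      then show ?thesis using less.prems by blast
    next
      case False
      then obtain e where e: "e \<in> arcs G" "tail G e = u"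
        unfolding out_degree_def by (metis card.empty equals0I in_out_arcs_conv)
      then have "u \<rightarrow> head G e"
        using in_arcs_imp_in_arcs_ends by blast
      then show ?thesis
        using less.IH[of "head G e"] e by (meson adj_reachable_trans converse_iff head_in_verts)
    qed
  qed
qed

lemma (in wf_digraph) awalk_verts_consecutive:
  assumes "awalk u p t" "awalk_verts u p = us @ v # w # ws"
  shows "\<exists>e \<in> arcs G. tail G e = v \<and> head G e = w"
  using assms
proof (induction p arbitrary: u us)
  case Nil
  then show ?case by simp
next
  case (Cons e p)
  then have e: "e \<in> arcs G" "tail G e = u" "awalk (head G e) p t"
    by (auto simp: awalk_Cons_iff)
  show ?case
  proof (cases us)
    case Nil
    with Cons.prems have "awalk_verts (head G e) p = w # ws" "v = tail G e"
      by auto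
    moreover have "hd (awalk_verts (head G e) p) = head G e"
      using e(3) by blast
    ultimately show ?thesis using e(1) by auto
  next
    case (Cons a us')
    with Cons.prems have "awalk_verts (head G e) p = us' @ v # w # ws"
      by auto
    with Cons.IH e(3) show ?thesis by blast
  qed
qed

lemma (in fin_digraph) subgraph_out_degree:
  assumes "subgraph H G"
  shows "out_degree H v \<le> out_degree G v"
  unfolding out_degree_def
proof (rule card_mono)
  show "out_arcs H v \<subseteq> out_arcs G v"
    using assms by (auto simp: subgraph_def out_arcs_def compatible_head compatible_tail)
qed auto

section \<open>The program rooted at the pre-pivot\<close>

text \<open>The vertices reachable from \<open>v\<close> are closed under out-arcs, so their
  out-degrees are kept. Each of them other than \<open>v\<close> keeps the last arc of a walk from
  \<open>v\<close>, whereas an arc into \<open>v\<close> would close a cycle.\<close>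

lemma nbp_sub_program:
  assumes "nbp Z" "v \<in> verts (bp_graph Z)"
  shows "nbp (sub_program Z v)" "subgraph (bp_graph (sub_program Z v)) (bp_graph Z)"
proof -
  let ?G = "bp_graph Z"
  let ?H = "bp_graph (sub_program Z v)"
  interpret fin_digraph ?G
    using assms by (simp add: nbp_def)
  have acyc: "\<nexists>c. cycle c"
    and out: "\<And>u. u \<in> verts ?G \<Longrightarrow> out_degree ?G u = 0 \<longleftrightarrow> u = sink Z"
    using assms by (auto simp: nbp_def)
  have H: "verts ?H = {u. v \<rightarrow>\<^sup>*\<^bsub>?G\<^esub> u}" "tail ?H = tail ?G" "head ?H = head ?G"
    "arcs ?H = {e \<in> arcs ?G. v \<rightarrow>\<^sup>*\<^bsub>?G\<^esub> tail ?G e \<and> v \<rightarrow>\<^sup>*\<^bsub>?G\<^esub> head ?G e}"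
    by (auto simp: sub_program_def)
  have step: "v \<rightarrow>\<^sup>*\<^bsub>?G\<^esub> head ?G e" if "e \<in> arcs ?G" "v \<rightarrow>\<^sup>*\<^bsub>?G\<^esub> tail ?G e" for e
    using that by (meson in_arcs_imp_in_arcs_ends reachable_adj_trans)
  have sub: "{u. v \<rightarrow>\<^sup>*\<^bsub>?G\<^esub> u} \<subseteq> verts ?G"
    using reachable_in_verts by blast
  have sg: "subgraph ?H ?G"
    using induced_induce[OF sub] by (simp add: sub_program_def induced_imp_subgraph)
  show "subgraph ?H ?G" by (fact sg)
  interpret H: fin_digraph ?H
    using sg by (rule fin_digraph_subgraph)
  have acyc_H: "\<nexists>c. pre_digraph.cycle ?H c"
    using subgraph_cycle[OF sg] acyc by blast
  have in_deg: "in_degree ?H u = 0 \<longleftrightarrow> u = v" if "v \<rightarrow>\<^sup>*\<^bsub>?G\<^esub> u" for u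
  proof
    assume "in_degree ?H u = 0"
    then have no: "\<not> (e \<in> arcs ?H \<and> head ?H e = u)" for e
      using H.finite_in_arcs[of u] by (auto simp: in_degree_def in_arcs_def)
    show "u = v"
    proof (rule ccontr)
      assume "u \<noteq> v"
      with that obtain p where "awalk v p u" "p \<noteq> []"
        by (metis awalk_empty_ends reachable_awalk)
      then obtain q e where "awalk v q (tail ?G e)" "e \<in> arcs ?G" "head ?G e = u"
        by (cases p rule: rev_cases) (auto simp: awalk_simps)
      then show False
        using no[of e] that by (auto simp: H reachable_awalk)
    qed
  next
    assume "u = v"
    moreover have "False" if "e \<in> arcs ?H" "head ?H e = v" for e
    proof -
      have e: "e \<in> arcs ?G" "v \<rightarrow>\<^sup>*\<^bsub>?G\<^esub> tail ?G e" "head ?G e = v"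
        using that by (auto simp: H)
      then obtain p where "awalk v p (tail ?G e)"
        by (auto simp: reachable_awalk)
      moreover have "awalk (tail ?G e) [e] v"
        using e by (auto simp: awalk_simps)
      ultimately have "awalk v (p @ [e]) v"
        by (rule awalk_appendI)
      then show False
        using acyclic_awalk_closed[OF acyc] by blast
    qed
    ultimately show "in_degree ?H u = 0"
      by (auto simp: in_degree_def in_arcs_def)
  qed
  have out_deg: "out_degree ?H u = out_degree ?G u" if "v \<rightarrow>\<^sup>*\<^bsub>?G\<^esub> u" for u
  proof -
    have "out_arcs ?H u = out_arcs ?G u"
      using that step unfolding out_arcs_def H by blast
    then show ?thesis
      by (simp add: out_degree_def)
  qed
  obtain t where "v \<rightarrow>\<^sup>*\<^bsub>?G\<^esub> t" "out_degree ?G t = 0"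
    using acyclic_reaches_out_degree_0[OF acyc assms(2)] by blast
  then have sink: "v \<rightarrow>\<^sup>*\<^bsub>?G\<^esub> sink Z"
    using out[of t] reachable_in_verts(2)[of v t] by simp
  have "{u \<in> verts ?H. in_degree ?H u = 0} = {v}"
  proof (intro set_eqI)
    fix u
    show "u \<in> {u \<in> verts ?H. in_degree ?H u = 0} \<longleftrightarrow> u \<in> {v}"
      using in_deg[of u] assms(2) by (cases "u = v") (auto simp: H(1))
  qed
  moreover have "{u \<in> verts ?H. out_degree ?H u = 0} = {sink Z}"
  proof (intro set_eqI)
    fix u
    show "u \<in> {u \<in> verts ?H. out_degree ?H u = 0} \<longleftrightarrow> u \<in> {sink Z}"
      using out_deg[of u] out[of u] sink sub by (cases "u = sink Z") (auto simp: H(1))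
  qed
  moreover have "source (sub_program Z v) = v" "sink (sub_program Z v) = sink Z"
    by (simp_all add: sub_program_def)
  ultimately show "nbp (sub_program Z v)"
    using H.fin_digraph_axioms acyc_H unfolding nbp_def by simp
qed

text \<open>Degrees only drop in a subgraph, so no new junctions arise.\<close>

lemma subdivided_sub_program:
  assumes "nbp Z" "v \<in> verts (bp_graph Z)" "subdivided Z"
  shows "subdivided (sub_program Z v)"
proof -
  let ?G = "bp_graph Z"
  let ?H = "bp_graph (sub_program Z v)"
  interpret fin_digraph ?G
    using assms by (simp add: nbp_def)
  note sg = nbp_sub_program(2)[OF assms(1,2)]
  have junction: "junction Z u" if "junction (sub_program Z v) u" for u
    using that sg subgraph_in_degree[OF sg, of u] subgraph_out_degree[OF sg, of u]
    unfolding junction_def by (auto simp: subgraph_def)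
  have H: "tail ?H = tail ?G" "head ?H = head ?G" "label (sub_program Z v) = label Z"
    by (auto simp: sub_program_def)
  interpret H: wf_digraph ?H
    using sg by auto
  have "arcs ?H \<subseteq> arcs ?G"
    using sg by auto
  then show ?thesis
    using assms(3) junction H.tail_in_verts H.head_in_verts
    unfolding subdivided_def subdivision_vertex_def H by blast
qed

text \<open>All that is kept of the pivot is an arc from a read-once vertex to a non-read-once one.
  That \<open>R\<close> also passes through \<open>w\<close> is part of the proof.\<close>

lemma read_once_partition_from_pre_pivot:
  assumes Z: "smnbp d Z" "subdivided Z"
    and e: "e \<in> arcs (bp_graph Z)" "tail (bp_graph Z) e = v" "head (bp_graph Z) e = w"
    and v: "read_once_vertex Z v" and w: "\<not> read_once_vertex Z w"
    and R: "bp_path Z v R (sink Z)"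
  shows "read_once_partition Z (d - 1) R"
proof -
  let ?G = "bp_graph Z"
  have nbp: "nbp Z"
    and split: "\<And>p. bp_path Z (source Z) p (sink Z) \<Longrightarrow> read_once_partition Z d p"
    using Z(1) by (auto simp: smnbp_def read_once_partition_def)
  interpret fin_digraph ?G
    using nbp by (simp add: nbp_def)
  have acyc: "\<nexists>c. cycle c"
    and out: "{u \<in> verts ?G. out_degree ?G u = 0} = {sink Z}"
    using nbp by (auto simp: nbp_def)
  \<comment> \<open>The arc \<open>e\<close> leaves \<open>v\<close>, so \<open>v\<close> is not the
    sink and \<open>R\<close> has a first edge.\<close>
  have "out_degree ?G v \<noteq> 0"
    using e finite_out_arcs[of v] by (auto simp: out_degree_def out_arcs_def)
  moreover have "sink Z \<in> {u \<in> verts ?G. out_degree ?G u = 0}"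
    by (simp only: out singleton_iff)
  ultimately have "v \<noteq> sink Z"
    by auto
  then obtain e1 R1 where R1: "R = e1 # R1"
    using R by (cases R) (auto simp: apath_Nil_iff)
  have R1_walk: "e1 \<in> arcs ?G" "tail ?G e1 = v" "awalk (head ?G e1) R1 (sink Z)"
    using R by (auto simp: R1 apath_def awalk_Cons_iff)
  have out_unique: "e1 = f" if "out_degree ?G v \<le> 1" "f \<in> arcs ?G" "tail ?G f = v" for f
    using that R1_walk finite_out_arcs[of v]
    by (auto simp: out_degree_def card_le_Suc0_iff_eq)
  obtain Q where Q: "apath (source Z) Q w" "\<not> read_once Z Q"
    using w by (auto simp: read_once_vertex_def)
  then obtain Q' e' where Q': "Q = Q' @ [e']"
    by (cases Q rule: rev_cases) auto
  have walk: "awalk (source Z) Q' (tail ?G e')" "e' \<in> arcs ?G" "head ?G e' = w"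
    using Q(1) by (auto simp: Q' apath_def awalk_Cons_iff awalk_Nil_iff)
  \<comment> \<open>\<open>Q\<close> is spliced with any continuation \<open>S\<close> from
    \<open>w\<close>; the first piece cannot contain all of \<open>Q\<close>, so the others cover
    \<open>e' # S\<close>.\<close>
  have drop: "read_once_partition Z (d - 1) (e' # S) \<and> d - 1 \<noteq> 0" if "awalk w S (sink Z)" for S
  proof -
    have "awalk (source Z) (Q @ S) (sink Z)"
      using Q(1) that by (auto simp: apath_def intro: awalk_appendI simp del: awalk_append_iff)
    then have "read_once_partition Z d (Q' @ e' # S)"
      using split acyclic_awalk_imp_apath[OF acyc] by (simp add: Q')
    then show ?thesis
      using read_once_partition_drop_first[of Z d Q' e' S] Q(2) by (simp add: Q')
  qed
  show ?thesis
  proof (cases "tail ?G e' = v")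
    case True
    \<comment> \<open>\<open>Q'\<close> ends at the read-once vertex \<open>v\<close>, so only
      \<open>e'\<close> can bring in a repeated variable.\<close>
    then have "read_once Z Q'"
      using v walk(1) acyclic_awalk_imp_apath[OF acyc] by (auto simp: read_once_vertex_def)
    then have "label Z e' \<noteq> None"
      using Q(2) read_once_insert_unlabelled[of Z Q' e' Q] by (auto simp: Q')
    then have "subdivision_vertex Z v"
      using Z(2) walk(2) True by (auto simp: subdivided_def)
    then have "out_degree ?G v \<le> 1"
      by (auto simp: subdivision_vertex_def junction_def)
    then have "e1 = e'"
      using out_unique walk(2) True by blast
    then show ?thesis
      using drop R1_walk(3) walk(3) by (simp add: R1)
  next
    case False
    then have "e \<noteq> e'" using e by auto
    then have "card {e, e'} \<le> in_degree ?G w"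
      unfolding in_degree_def using e walk by (intro card_mono) auto
    then have "junction Z w"
      using \<open>e \<noteq> e'\<close> e by (auto simp: junction_def)
    \<comment> \<open>The head \<open>w\<close> of \<open>e\<close> is a junction, which rules out
      both a junction at its tail and a label on it.\<close>
    then have "\<not> junction Z v" and unlabelled: "label Z e = None"
      using Z(2) e by (auto simp: subdivided_def subdivision_vertex_def)
    then have "out_degree ?G v \<le> 1"
      using e by (auto simp: junction_def)
    then have "e1 = e"
      using out_unique e by blast
    \<comment> \<open>The edge \<open>e'\<close> is traded for \<open>e\<close>: its removal leaves
      a partition of \<open>R1\<close>, to which the unlabelled \<open>e\<close> is prepended. If
      \<open>R1\<close> is empty, \<open>d - 1 \<noteq> 0\<close> provides the piece for
      \<open>e\<close>.\<close>
    with R1_walk(3) e have "read_once_partition Z (d - 1) ([e'] @ R1)" "d - 1 \<noteq> 0"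
      using drop by auto
    then show ?thesis
      using read_once_partition_Cons_unlabelled[OF read_once_partition_suffix _ unlabelled]
      unfolding R1 \<open>e1 = e\<close> by blast
  qed
qed

theorem theorem9:
  fixes Z :: "('v, 'e, 'x) branching_program" and d :: nat
  assumes "d \<ge> 1"
    and "smnbp d Z" and "subdivided Z"
    and "bp_path Z (source Z) P (sink Z)" and "\<not> read_once Z P"
    and "is_pre_pivot Z P v" and "is_pivot Z P w"
  shows "smnbp (d - 1) (sub_program Z v) \<and> subdivided (sub_program Z v)"
proof -
  let ?G = "bp_graph Z"
  let ?Y = "sub_program Z v"
  let ?H = "bp_graph ?Y"
  have nbp: "nbp Z"
    using assms(2) by (simp add: smnbp_def)
  interpret fin_digraph ?G
    using nbp by (simp add: nbp_def)
  have acyc: "\<nexists>c. cycle c"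
    and out: "{u \<in> verts ?G. out_degree ?G u = 0} = {sink Z}"
    using nbp by (auto simp: nbp_def)
  have P: "awalk (source Z) P (sink Z)" "distinct (awalk_verts (source Z) P)"
    using assms(4) by (auto simp: apath_def)
  obtain us w' ws where us: "awalk_verts (source Z) P = us @ v # w' # ws" and "is_pivot Z P w'"
    using assms(6) unfolding is_pre_pivot_def by blast
  then obtain us' ws' where us': "awalk_verts (source Z) P = us' @ w' # ws'"
    and w': "\<not> read_once_vertex Z w'" and before: "\<forall>u \<in> set us'. read_once_vertex Z u"
    unfolding is_pivot_def by blast
  \<comment> \<open>\<open>w'\<close> occurs only once on \<open>P\<close>, so the two
    decompositions agree and \<open>v\<close> lies among the read-once vertices before the
    pivot.\<close>
  have "(us @ [v]) @ w' # ws = us' @ w' # ws'" "distinct ((us @ [v]) @ w' # ws)"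
    using P(2) us us' by auto
  then have "us @ [v] = us'"
    by (auto simp: append_eq_append_conv2 append_eq_Cons_conv Cons_eq_append_conv)
  with before have v: "read_once_vertex Z v"
    by auto
  obtain e where e: "e \<in> arcs ?G" "tail ?G e = v" "head ?G e = w'"
    using awalk_verts_consecutive[OF P(1) us] by blast
  then have v_in: "v \<in> verts ?G"
    by auto
  note partition = read_once_partition_from_pre_pivot[OF assms(2,3) e v w']
  note sg = nbp_sub_program(2)[OF nbp v_in]
  have Y: "source ?Y = v" "sink ?Y = sink Z" "label ?Y = label Z"
    "verts ?H = {u. v \<rightarrow>\<^sup>*\<^bsub>?G\<^esub> u}"
    by (auto simp: sub_program_def)
  have read_once_Y: "read_once ?Y q = read_once Z q" for q
    by (simp add: read_once_def Y(3))
  \<comment> \<open>The path is extended backwards to \<open>v\<close> and forwards to the sink, so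
    that \<open>partition\<close> bounds the multiplicities on the whole.\<close>
  have "card {e \<in> set p. edge_var ?Y e = Some x} \<le> d - 1" if p: "bp_path ?Y a p b" for a p b x
  proof -
    interpret H: wf_digraph ?H
      using sg by auto
    have "a \<in> verts ?H"
      using p by (auto simp: H.apath_def H.awalk_def)
    then obtain r where r: "awalk v r a"
      by (auto simp: Y reachable_awalk)
    have apb: "awalk a p b"
      using subgraph_apath_imp_apath[OF p sg] by (simp add: apath_def)
    then have "b \<in> verts ?G"
      by auto
    then obtain t where t: "b \<rightarrow>\<^sup>*\<^bsub>?G\<^esub> t" "out_degree ?G t = 0"
      using acyclic_reaches_out_degree_0[OF acyc] by blast
    then have "t = sink Z"
      using out reachable_in_verts(2)[OF t(1)] by blast
    with t obtain s where s: "awalk b s (sink Z)"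
      by (auto simp: reachable_awalk)
    have "awalk v (r @ p @ s) (sink Z)"
      using r apb s by (blast intro: awalk_appendI)
    then have "card {e \<in> set (r @ p @ s). edge_var Z e = Some x} \<le> d - 1"
      by (intro card_variable_le_read_once_partition partition acyclic_awalk_imp_apath[OF acyc])
    moreover have "card {e \<in> set p. edge_var Z e = Some x}
        \<le> card {e \<in> set (r @ p @ s). edge_var Z e = Some x}"
      by (rule card_mono) auto
    ultimately show ?thesis
      by (simp add: Y(3))
  qed
  moreover have "\<exists>ps. concat ps = p \<and> length ps \<le> d - 1 \<and> (\<forall>q \<in> set ps. read_once ?Y q)"
    if p: "bp_path ?Y (source ?Y) p (sink ?Y)" for p
    using partition[OF subgraph_apath_imp_apath[OF p[unfolded Y(1,2)] sg]]
    unfolding read_once_Y read_once_partition_def .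
  moreover have "label ?Y f \<noteq> Some (Neg x)" if "f \<in> arcs ?H" for f x
  proof -
    have "f \<in> arcs ?G"
      using sg that by (auto simp: subgraph_def)
    then show ?thesis
      using assms(2) by (simp add: smnbp_def Y(3))
  qed
  ultimately have "smnbp (d - 1) ?Y"
    using nbp_sub_program(1)[OF nbp v_in] by (simp only: smnbp_def) simp
  then show ?thesis
    using subdivided_sub_program[OF nbp v_in assms(3)] ..
qed

end
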